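(* Let $\mathbb{X}$ be a real Banach space and let $\mathcal{B}=(e_n)_{n=1}^\infty$ be a semi-normalized Schauder basis of $\mathbb{X}$. The following are equivalent: (a) $\mathcal{B}$ is $1$-greedy; (b) $\mathcal{B}$ has Property $(Q^* )$ with constant $1$; (c) $\mathcal{B}$ is $1$-suppression unconditional and has Property (A) with constant $1$.
   Context: Setting: $\mathbb{X}$ is a real Banach space and $\mathcal{B}=(e_n)_{n=1}^\infty$ is a Schauder basis of $\mathbb{X}$ with biorthogonal functionals $(e_n^* )$, semi-normalized: $0<\inf_n\|e_n\|\le\sup_n\|e_n\|<\infty$. Here $\mathbb{N}=\{1,2,\dots\}$. Notation: $\mathrm{supp}(x)=\{n: e_n^*(x)\ne0\}$; $\mathbb{X}_c$ is the set of $x\in\mathbb{X}$ with finite support; $\|\tilde x\|_\infty=\sup_n|e_n^*(x)|$; $xy=0$ means $\mathrm{supp}(x)\cap\mathrm{supp}(y)=\emptyset$; $P_A(x)=\sum_{n\in A}e_n^*(x)e_n$; $|A|$ is the cardinality of $A$; $[\,\cdot\,]$ denotes linear span and $d(x,V)=\inf_{v\in V}\|x-v\|$. Greedy sums: the natural greedy ordering of $x$ is the injective map $\rho:\mathbb{N}\to\mathbb{N}$ with $\mathrm{supp}(x)\subset\rho(\mathbb{N})$ such that if $j<k$ then either $|e^*_{\rho(j)}(x)|>|e^*_{\rho(k)}(x)|$, or $|e^*_{\rho(j)}(x)|=|e^*_{\rho(k)}(x)|$ and $\rho(j)<\rho(k)$; and $\mathcal{G}_m(x)=\sum_{j=1}^m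 e^*_{\rho(j)}(x)e_{\rho(j)}$. Let $\sigma_m(x)=\inf\{d(x,[e_n,n\in A]): A\subset\mathbb{N},|A|=m\}$. $\mathcal{B}$ is $C$-greedy if $\|x-\mathcal{G}_m(x)\|\le C\sigma_m(x)$ for all $x\in\mathbb{X}$, $m\in\mathbb{N}$. $\mathcal{B}$ is $C$-suppression unconditional if $\|P_A(x)\|\le C\|x\|$ for all $x\in\mathbb{X}$ and $A\subset\mathbb{N}$. For $z\in\mathbb{X}_c$ let $\Gamma_0=\mathbb{X}_c$ and, for $z\neq0$, $\Gamma_z=\{y\in\mathbb{X}_c: zy=0,\ |\mathrm{supp}(z)|\le|\{n:|e_n^*(y)|=1\}|\}$. Property $(Q^* )$ with constant $C$: $\|x+z\|\le C\|x+y\|$ for all $x,z,y\in\mathbb{X}_c$ with $xz=0$, $xy=0$, $\max\{\|\tilde x\|_\infty,\|\tilde z\|_\infty\}\le1$ and $y\in\Gamma_z$. Property (A) with constant $C$: for a nonzero $x\in\mathbb{X}_c$ with $S=\mathrm{supp}(x)$, put $n_{\max}(x)=\max S$ and $M(x)=\{n\in S:|e_n^*(x)|=\max_m|e_m^*(x)|\}$. The property requires $$\|x\|\le C\Big\|\sum_{n\in M(x)}\theta_n e_n^*(x)e_{\pi(n)}+(x-P_{M(x)}(x))\Big\|$$ for every such $x$, every injective map $\pi:S\to[1,n_{\max}(x)]\cap\mathbb{N}$ with $\pi(j)=j$ for $j\in S\setminus M(x)$, and all signs $\theta_n\in\{\pm1\}$ ($n\in M(x)$) with $\theta_n=1$ whenever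 $\pi(n)=n$. *)

theory Defs
  imports "HOL-Analysis.Analysis"
begin

text \<open>
  Basis vectors are indexed by \<open>nat\<close> starting at \<open>0\<close>: \<open>e n\<close> is the vector \<open>e\<^sub>n\<^sub>+\<^sub>1\<close> of a basis
  indexed by \<open>{1, 2, \<dots>}\<close>.  Only the order of the indices matters below.
\<close>

definition schauder_basis :: "(nat \<Rightarrow> 'a::banach) \<Rightarrow> bool" where
  "schauder_basis e \<longleftrightarrow> (\<forall>x. \<exists>!a :: nat \<Rightarrow> real. (\<lambda>n. a n *\<^sub>R e n) sums x)"

definition semi_normalized :: "(nat \<Rightarrow> 'a::banach) \<Rightarrow> bool" where
  "semi_normalized e \<longleftrightarrow>
     0 < (INF n. norm (e n)) \<and> bdd_above (range (\<lambda>n. norm (e n)))"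

text \<open>The biorthogonal functional \<open>e\<^sub>n\<^sup>*\<close>; meaningful when \<open>e\<close> is a Schauder basis.\<close>

definition coord :: "(nat \<Rightarrow> 'a::banach) \<Rightarrow> nat \<Rightarrow> 'a \<Rightarrow> real" where
  "coord e n x = (THE a :: nat \<Rightarrow> real. (\<lambda>k. a k *\<^sub>R e k) sums x) n"

definition bsupp :: "(nat \<Rightarrow> 'a::banach) \<Rightarrow> 'a \<Rightarrow> nat set" where
  "bsupp e x = {n. coord e n x \<noteq> 0}"

definition fin_supp :: "(nat \<Rightarrow> 'a::banach) \<Rightarrow> 'a set" where
  "fin_supp e = {x. finite (bsupp e x)}"

text \<open>
  The supremum is over a bounded set when \<open>e\<close> is a semi-normalized Schauder basis, since
  then the coordinates of \<open>x\<close> tend to \<open>0\<close>.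
\<close>

definition coord_sup :: "(nat \<Rightarrow> 'a::banach) \<Rightarrow> 'a \<Rightarrow> real" where
  "coord_sup e x = (SUP n. \<bar>coord e n x\<bar>)"

definition disj :: "(nat \<Rightarrow> 'a::banach) \<Rightarrow> 'a \<Rightarrow> 'a \<Rightarrow> bool" where
  "disj e x y \<longleftrightarrow> bsupp e x \<inter> bsupp e y = {}"

definition proj_term :: "(nat \<Rightarrow> 'a::banach) \<Rightarrow> nat set \<Rightarrow> 'a \<Rightarrow> nat \<Rightarrow> 'a" where
  "proj_term e A x n = (if n \<in> A then coord e n x *\<^sub>R e n else 0)"

definition proj :: "(nat \<Rightarrow> 'a::banach) \<Rightarrow> nat set \<Rightarrow> 'a \<Rightarrow> 'a" where
  "proj e A x = (\<Sum>n. proj_term e A x n)"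

text \<open>
  For infinite \<open>A\<close> the series defining \<open>proj e A x\<close> may diverge; its convergence is part of
  the condition.
\<close>

definition suppression_unconditional :: "real \<Rightarrow> (nat \<Rightarrow> 'a::banach) \<Rightarrow> bool" where
  "suppression_unconditional C e \<longleftrightarrow>
     (\<forall>x A. summable (proj_term e A x) \<and> norm (proj e A x) \<le> C * norm x)"

definition greedy_ordering :: "(nat \<Rightarrow> 'a::banach) \<Rightarrow> 'a \<Rightarrow> (nat \<Rightarrow> nat) \<Rightarrow> bool" where
  "greedy_ordering e x \<rho> \<longleftrightarrow>
     inj \<rho> \<and> bsupp e x \<subseteq> range \<rho> \<and>
     (\<forall>j k. j < k \<longrightarrow>
        \<bar>coord e (\<rho> j) x\<bar> > \<bar>coord e (\<rho> k) x\<bar> \<or>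
        \<bar>coord e (\<rho> j) x\<bar> = \<bar>coord e (\<rho> k) x\<bar> \<and> \<rho> j < \<rho> k)"

text \<open>
  If \<open>x\<close> has finite support, a greedy ordering is determined only up to the indices with zero
  coordinate.  These do not contribute to the sum, so the choice of \<open>\<rho>\<close> is immaterial.
\<close>

definition greedy_sum :: "(nat \<Rightarrow> 'a::banach) \<Rightarrow> nat \<Rightarrow> 'a \<Rightarrow> 'a" where
  "greedy_sum e m x =
     (let \<rho> = (SOME \<rho>. greedy_ordering e x \<rho>)
      in \<Sum>j<m. coord e (\<rho> j) x *\<^sub>R e (\<rho> j))"

definition best_approx_error :: "(nat \<Rightarrow> 'a::banach) \<Rightarrow> nat \<Rightarrow> 'a \<Rightarrow> real" where
  "best_approx_error e m x =
     (INF A \<in> {A. finite A \<and> card A = m}. infdist x (span (e ` A)))"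

definition greedy_basis :: "real \<Rightarrow> (nat \<Rightarrow> 'a::banach) \<Rightarrow> bool" where
  "greedy_basis C e \<longleftrightarrow>
     (\<forall>x. \<forall>m\<ge>1. norm (x - greedy_sum e m x) \<le> C * best_approx_error e m x)"

definition Gamma_set :: "(nat \<Rightarrow> 'a::banach) \<Rightarrow> 'a \<Rightarrow> 'a set" where
  "Gamma_set e z =
     (if z = 0 then fin_supp e
      else {y \<in> fin_supp e. disj e z y \<and> card (bsupp e z) \<le> card {n. \<bar>coord e n y\<bar> = 1}})"

definition property_Q_star :: "real \<Rightarrow> (nat \<Rightarrow> 'a::banach) \<Rightarrow> bool" where
  "property_Q_star C e \<longleftrightarrow>
     (\<forall>x \<in> fin_supp e. \<forall>z \<in> fin_supp e. \<forall>y \<in> fin_supp e.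
        disj e x z \<longrightarrow> disj e x y \<longrightarrow> max (coord_sup e x) (coord_sup e z) \<le> 1 \<longrightarrow>
        y \<in> Gamma_set e z \<longrightarrow>
        norm (x + z) \<le> C * norm (x + y))"

definition max_coords :: "(nat \<Rightarrow> 'a::banach) \<Rightarrow> 'a \<Rightarrow> nat set" where
  "max_coords e x = {n \<in> bsupp e x. \<bar>coord e n x\<bar> = coord_sup e x}"

text \<open>
  The values of \<open>\<pi>\<close> and \<open>\<theta>\<close> outside \<open>S\<close> and \<open>M\<close>, respectively, are irrelevant.
\<close>

definition property_A :: "real \<Rightarrow> (nat \<Rightarrow> 'a::banach) \<Rightarrow> bool" where
  "property_A C e \<longleftrightarrow>
     (\<forall>x \<in> fin_supp e. x \<noteq> 0 \<longrightarrow>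
       (let S = bsupp e x; M = max_coords e x in
        \<forall>(\<pi> :: nat \<Rightarrow> nat) (\<theta> :: nat \<Rightarrow> real).
          inj_on \<pi> S \<and> \<pi> ` S \<subseteq> {..Max S} \<and> (\<forall>j \<in> S - M. \<pi> j = j) \<and>
          (\<forall>n \<in> M. \<theta> n \<in> {1, -1}) \<and> (\<forall>n \<in> M. \<pi> n = n \<longrightarrow> \<theta> n = 1) \<longrightarrow>
          norm x \<le> C * norm ((\<Sum>n\<in>M. (\<theta> n * coord e n x) *\<^sub>R e (\<pi> n)) + (x - proj e M x))))"

end

theory Submission
  imports Defs
begin

text \<open>
  Each of the three conditions amounts to two inequalities for finite linear combinations.
  The first (\<open>suppressing\<close>) says that deleting terms does not increase the norm, which makes the
  norm monotone in the modulus of every single coefficient.  The second (\<open>exchange\<close>) says that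
  terms with coefficients of modulus at most \<open>t\<close> may be traded for equally many terms elsewhere
  with coefficients of modulus exactly \<open>t\<close>, all remaining coefficients being at most \<open>t\<close>.
  From greediness both are obtained by enlarging the coefficients on a set so that the greedy
  sum is forced to select it.  Conversely, the error of an approximation supported on \<open>B\<close> is
  reduced to that of the greedy set \<open>A\<close> by deleting \<open>B\<close>, shrinking the coefficients on
  \<open>A - B\<close> to the smallest modulus occurring in \<open>A\<close>, and exchanging \<open>A - B\<close> for \<open>B - A\<close>;
  partial sums pass this on to vectors of infinite support.
\<close>

section \<open>Greedy enumeration of a nonnegative null sequence\<close>

text \<open>Since each set on which \<open>c\<close> is at least a positive number is finite, a
  largest value exists off any finite set. Choosing the least index of largest remaining value again
  and again gives the enumeration.\<close>

lemma ex_decreasing_enumeration: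
  fixes c :: "nat \<Rightarrow> real"
  assumes nonneg: "\<And>n. 0 \<le> c n" and fin: "\<And>d. 0 < d \<Longrightarrow> finite {n. d \<le> c n}"
  shows "\<exists>\<rho> :: nat \<Rightarrow> nat. inj \<rho> \<and> {n. c n \<noteq> 0} \<subseteq> range \<rho> \<and>
           (\<forall>j k. j < k \<longrightarrow> c (\<rho> k) < c (\<rho> j) \<or> c (\<rho> j) = c (\<rho> k) \<and> \<rho> j < \<rho> k)"
proof -
  \<comment> \<open>\<open>P f x r\<close> says that \<open>r\<close> is the greedy choice at stage
    \<open>x\<close>. It depends on \<open>f\<close> only through its values below \<open>x\<close>,
    as a recursive choice requires.\<close>
  define P where "P f x r \<longleftrightarrow> r \<notin> f ` {..<x} \<and>
    (\<forall>k. k \<notin> f ` {..<x} \<longrightarrow> k \<noteq> r \<longrightarrow> c k < c r \<or> c k = c r \<and> r < k)"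
    for f :: "nat \<Rightarrow> nat" and x r :: nat
  have pick: "\<exists>r. r \<notin> F \<and> (\<forall>k. k \<notin> F \<longrightarrow> k \<noteq> r \<longrightarrow> c k < c r \<or> c k = c r \<and> r < k)"
    if "finite F" for F
  proof -
    have "\<exists>l. l \<notin> F \<and> (\<forall>k. k \<notin> F \<longrightarrow> c k \<le> c l)"
    proof (cases "\<exists>n. n \<notin> F \<and> 0 < c n")
      case True
      then obtain n where n: "n \<notin> F" "0 < c n" by blast
      define K where "K = {k. c n \<le> c k} - F"
      have K: "finite K" "K \<noteq> {}" using n fin[of "c n"] by (auto simp: K_def)
      obtain l where l: "l \<in> K" "\<And>k. k \<in> K \<Longrightarrow> c k \<le> c l"
        using Max_in[of "c ` K"] Max_ge[of "c ` K"] K by (metis finite_imageI imageE image_eqI image_is_empty)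
      have "c k \<le> c l" if "k \<notin> F" for k
        using l that by (cases "k \<in> K") (auto simp: K_def)
      then show ?thesis using l(1) by (auto simp: K_def)
    next
      case False
      moreover obtain l where "l \<notin> F" using that \<open>finite F\<close> ex_new_if_finite infinite_UNIV_nat by blast
      ultimately show ?thesis using nonneg by (metis linorder_not_less order.trans)
    qed
    then obtain l where l: "l \<notin> F" "\<And>k. k \<notin> F \<Longrightarrow> c k \<le> c l" by blast
    \<comment> \<open>Taking the least of all maximisers is what implements the tie-breaking
      rule.\<close>
    define r where "r = (LEAST k. k \<notin> F \<and> c k = c l)"
    have r: "r \<notin> F" "c r = c l" using LeastI[of "\<lambda>k. k \<notin> F \<and> c k = c l" l] l(1) by (auto simp: r_def)
    have "r \<le> k" if "k \<notin> F" "c k = c l" for k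
      unfolding r_def using that by (intro Least_le) auto
    with r l(2) show ?thesis by (metis le_neq_implies_less order_le_less)
  qed
  have "\<exists>\<rho>. \<forall>x. P \<rho> x (\<rho> x)"
  proof (rule dependent_wellorder_choice)
    fix r :: nat and f g :: "nat \<Rightarrow> nat" and x :: nat
    assume "\<And>y. y < x \<Longrightarrow> f y = g y"
    then have "f ` {..<x} = g ` {..<x}" by auto
    then show "P f x r = P g x r" by (simp add: P_def)
  next
    fix x :: nat and f :: "nat \<Rightarrow> nat"
    show "\<exists>r. P f x r" unfolding P_def by (rule pick) simp
  qed
  then obtain \<rho> where \<rho>: "\<And>x. P \<rho> x (\<rho> x)" by blast
  have new: "\<rho> x \<notin> \<rho> ` {..<x}" for x
    using \<rho>[of x] unfolding P_def by (rule conjunct1)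
  have best: "c k < c (\<rho> x) \<or> c k = c (\<rho> x) \<and> \<rho> x < k" if "k \<notin> \<rho> ` {..<x}" "k \<noteq> \<rho> x" for x k
    using \<rho>[of x, unfolded P_def, THEN conjunct2, rule_format, OF that] .
  have inj: "inj \<rho>"
  proof (rule linorder_injI)
    fix j k :: nat assume "j < k"
    then have "\<rho> j \<in> \<rho> ` {..<k}" by simp
    then show "\<rho> j \<noteq> \<rho> k" using new[of k] by metis
  qed
  have ord: "c (\<rho> k) < c (\<rho> j) \<or> c (\<rho> j) = c (\<rho> k) \<and> \<rho> j < \<rho> k" if "j < k" for j k
  proof -
    have "\<rho> k \<notin> \<rho> ` {..<j}" "\<rho> k \<noteq> \<rho> j"
      using inj that by (auto simp: inj_eq)
    then show ?thesis using best[of "\<rho> k" j] by auto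
  qed
  \<comment> \<open>An index of positive value that is never chosen would lose to every chosen one,
    so infinitely many values would be at least \<open>c n\<close>.\<close>
  have range: "n \<in> range \<rho>" if "c n \<noteq> 0" for n
  proof (rule ccontr)
    assume n: "n \<notin> range \<rho>"
    have "c n \<le> c (\<rho> j)" for j
    proof -
      have "n \<notin> \<rho> ` {..<j}" "n \<noteq> \<rho> j" using n by auto
      then show ?thesis using best[of n j] by auto
    qed
    then have "range \<rho> \<subseteq> {k. c n \<le> c k}" by auto
    moreover have "0 < c n" using nonneg[of n] that by simp
    ultimately have "finite (range \<rho>)" using fin finite_subset by blast
    then show False using inj by (simp add: finite_image_iff)
  qed
  show ?thesis
  proof (intro exI[of _ \<rho>] conjI allI impI)
    show "inj \<rho>" by (rule inj)
    show "{n. c n \<noteq> 0} \<subseteq> range \<rho>" using range by blast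
  qed (rule ord)
qed

section \<open>Finite linear combinations and the two basic inequalities\<close>

locale seminormalized_basis =
  fixes e :: "nat \<Rightarrow> 'a::banach"
  assumes schauder: "schauder_basis e" and semi_norm: "semi_normalized e"
begin

definition comb :: "(nat \<Rightarrow> real) \<Rightarrow> nat set \<Rightarrow> 'a" where
  "comb a S = (\<Sum>n\<in>S. a n *\<^sub>R e n)"

definition suppressing :: bool where
  "suppressing \<longleftrightarrow> (\<forall>S T a. finite T \<longrightarrow> S \<subseteq> T \<longrightarrow> norm (comb a S) \<le> norm (comb a T))"

text \<open>One coefficient function serves both sides because \<open>S\<close>, \<open>D\<close>
  and \<open>B\<close> are pairwise disjoint. Only the moduli on \<open>B\<close> are prescribed, so
  arbitrary signs are included.\<close>

definition exchange :: bool where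
  "exchange \<longleftrightarrow> (\<forall>S D B a t. finite S \<longrightarrow> finite D \<longrightarrow> finite B \<longrightarrow>
     S \<inter> D = {} \<longrightarrow> S \<inter> B = {} \<longrightarrow> D \<inter> B = {} \<longrightarrow> card D = card B \<longrightarrow>
     (\<forall>n\<in>S \<union> D. \<bar>a n\<bar> \<le> t) \<longrightarrow> (\<forall>n\<in>B. \<bar>a n\<bar> = t) \<longrightarrow>
     norm (comb a (S \<union> D)) \<le> norm (comb a (S \<union> B)))"

lemma suppressingD: "suppressing \<Longrightarrow> finite T \<Longrightarrow> S \<subseteq> T \<Longrightarrow> norm (comb a S) \<le> norm (comb a T)"
  by (simp add: suppressing_def)

lemma exchangeD:
  assumes exchange "finite S" "finite D" "finite B"
    "S \<inter> D = {}" "S \<inter> B = {}" "D \<inter> B = {}" "card D = card B"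
    "\<And>n. n \<in> S \<union> D \<Longrightarrow> \<bar>a n\<bar> \<le> t" "\<And>n. n \<in> B \<Longrightarrow> \<bar>a n\<bar> = t"
  shows "norm (comb a (S \<union> D)) \<le> norm (comb a (S \<union> B))"
  using assms(1)[unfolded exchange_def, rule_format, of S D B a t] assms(2-) by blast

lemma comb_cong: "(\<And>n. n \<in> S \<Longrightarrow> a n = b n) \<Longrightarrow> comb a S = comb b S"
  by (simp add: comb_def)

lemma comb_Un: "finite S \<Longrightarrow> finite T \<Longrightarrow> S \<inter> T = {} \<Longrightarrow> comb a (S \<union> T) = comb a S + comb a T"
  by (simp add: comb_def sum.union_disjoint)

lemma comb_Diff: "finite T \<Longrightarrow> S \<subseteq> T \<Longrightarrow> comb a (T - S) = comb a T - comb a S"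
  by (simp add: comb_def sum_diff)

lemma comb_scale: "comb (\<lambda>n. k * a n) S = k *\<^sub>R comb a S"
  by (simp add: comb_def scaleR_sum_right)

lemma comb_mono_neutral:
  "finite T \<Longrightarrow> S \<subseteq> T \<Longrightarrow> (\<And>n. n \<in> T - S \<Longrightarrow> a n = 0) \<Longrightarrow> comb a S = comb a T"
  unfolding comb_def by (rule sum.mono_neutral_left) auto

text \<open>Disposes of the degenerate cases: for \<open>t \<le> 0\<close> the left side vanishes,
  and if \<open>D\<close> is empty then so is \<open>B\<close>. Later arguments may divide by
  \<open>t\<close> and pick an element of \<open>D\<close>.\<close>

lemma exchangeI:
  assumes *: "\<And>S D B a t. finite S \<Longrightarrow> finite D \<Longrightarrow> finite B \<Longrightarrow>
     S \<inter> D = {} \<Longrightarrow> S \<inter> B = {} \<Longrightarrow> D \<inter> B = {} \<Longrightarrow> card D = card B \<Longrightarrow>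
     (\<And>n. n \<in> S \<union> D \<Longrightarrow> \<bar>a n\<bar> \<le> t) \<Longrightarrow> (\<And>n. n \<in> B \<Longrightarrow> \<bar>a n\<bar> = t) \<Longrightarrow>
     0 < t \<Longrightarrow> D \<noteq> {} \<Longrightarrow> norm (comb a (S \<union> D)) \<le> norm (comb a (S \<union> B))"
  shows exchange
  unfolding exchange_def
proof (intro allI impI)
  fix S D B :: "nat set" and a :: "nat \<Rightarrow> real" and t :: real
  assume H: "finite S" "finite D" "finite B" "S \<inter> D = {}" "S \<inter> B = {}" "D \<inter> B = {}" "card D = card B"
    and le: "\<forall>n\<in>S \<union> D. \<bar>a n\<bar> \<le> t" and eq: "\<forall>n\<in>B. \<bar>a n\<bar> = t"
  consider "t \<le> 0" | "D = {}" | "0 < t" "D \<noteq> {}" by linarith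
  then show "norm (comb a (S \<union> D)) \<le> norm (comb a (S \<union> B))"
  proof cases
    case 1
    have "a n = 0" if "n \<in> S \<union> D" for n using le[rule_format, OF that] 1 by linarith
    then have "comb a (S \<union> D) = 0" unfolding comb_def by (intro sum.neutral) auto
    then show ?thesis by simp
  next
    case 2
    then show ?thesis using H by auto
  next
    case 3
    then show ?thesis using *[OF H] le eq by blast
  qed
qed

section \<open>Coordinates: uniqueness, finite combinations, decay\<close>

lemma coord_unique: "(\<lambda>n. a n *\<^sub>R e n) sums x \<Longrightarrow> coord e n x = a n"
proof -
  assume "(\<lambda>n. a n *\<^sub>R e n) sums x"
  moreover have "\<exists>!a :: nat \<Rightarrow> real. (\<lambda>n. a n *\<^sub>R e n) sums x"
    using schauder by (simp add: schauder_basis_def)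
  ultimately show ?thesis unfolding coord_def by (metis (mono_tags, lifting) the1_equality)
qed

lemma coord_sums: "(\<lambda>n. coord e n x *\<^sub>R e n) sums x"
proof -
  obtain a :: "nat \<Rightarrow> real" where a: "(\<lambda>n. a n *\<^sub>R e n) sums x"
    using schauder unfolding schauder_basis_def by blast
  have "(\<lambda>n. coord e n x *\<^sub>R e n) = (\<lambda>n. a n *\<^sub>R e n)" using coord_unique[OF a] by simp
  then show ?thesis using a by simp
qed

lemma coord_comb:
  assumes "finite S" shows "coord e n (comb a S) = (if n \<in> S then a n else 0)"
proof -
  have "(\<lambda>n. (if n \<in> S then a n *\<^sub>R e n else 0)) sums (comb a S)"
    unfolding comb_def using assms by (rule sums_If_finite_set)
  then have "(\<lambda>n. (if n \<in> S then a n else 0) *\<^sub>R e n) sums (comb a S)"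
    by (rule back_subst[of "\<lambda>f. f sums _"]) auto
  from coord_unique[OF this] show ?thesis .
qed

lemma bsupp_comb: "finite S \<Longrightarrow> bsupp e (comb a S) = {n\<in>S. a n \<noteq> 0}"
  by (auto simp: bsupp_def coord_comb)

lemma comb_in_fin_supp [simp]: "finite S \<Longrightarrow> comb a S \<in> fin_supp e"
  by (simp add: fin_supp_def bsupp_comb)

lemma comb_coord:
  assumes "finite S" "bsupp e x \<subseteq> S" shows "comb (\<lambda>n. coord e n x) S = x"
proof -
  have "(\<lambda>n. coord e n x *\<^sub>R e n) sums (comb (\<lambda>n. coord e n x) S)"
    unfolding comb_def using assms by (intro sums_finite) (auto simp: bsupp_def)
  then show ?thesis using coord_sums sums_unique2 by blast
qed

lemma coord_zero [simp]: "coord e n 0 = 0"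
  using coord_comb[of "{}"] by (simp add: comb_def)

lemma fin_suppD: "x \<in> fin_supp e \<Longrightarrow> finite (bsupp e x)"
  by (simp add: fin_supp_def)

text \<open>The terms of the convergent expansion of \<open>x\<close> tend to 0, and
  semi-normalization bounds the norms of the basis vectors away from 0.\<close>

lemma coord_tendsto_0: "(\<lambda>n. coord e n x) \<longlonglongrightarrow> 0"
proof -
  define d where "d = (INF n. norm (e n))"
  have d: "0 < d" using semi_norm by (simp add: semi_normalized_def d_def)
  have de: "d \<le> norm (e n)" for n unfolding d_def by (rule cINF_lower) (auto intro: bdd_belowI[of _ 0])
  have "(\<lambda>n. coord e n x *\<^sub>R e n) \<longlonglongrightarrow> 0"
    using coord_sums sums_summable summable_LIMSEQ_zero by blast
  then have "(\<lambda>n. norm (coord e n x *\<^sub>R e n) / d) \<longlonglongrightarrow> 0"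
    using tendsto_divide[OF tendsto_norm_zero tendsto_const, of "\<lambda>n. coord e n x *\<^sub>R e n" sequentially d] d by simp
  moreover have "\<forall>\<^sub>F n in sequentially. norm (coord e n x) \<le> norm (coord e n x *\<^sub>R e n) / d"
    using d de by (intro always_eventually allI) (simp add: pos_le_divide_eq mult_left_mono)
  ultimately show ?thesis by (rule Lim_null_comparison[rotated])
qed

lemma finite_large_coord: "0 < d \<Longrightarrow> finite {n. d \<le> \<bar>coord e n x\<bar>}"
proof -
  assume "0 < d"
  then obtain N where "\<And>n. n \<ge> N \<Longrightarrow> \<bar>coord e n x\<bar> < d"
    using LIMSEQ_D[OF coord_tendsto_0, of d x] by auto
  then have "{n. d \<le> \<bar>coord e n x\<bar>} \<subseteq> {..<N}" by (force simp: not_less[symmetric])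
  then show ?thesis using finite_subset by blast
qed

lemma bdd_above_coord: "x \<in> fin_supp e \<Longrightarrow> bdd_above (range (\<lambda>n. \<bar>coord e n x\<bar>))"
proof -
  assume "x \<in> fin_supp e"
  moreover have "range (\<lambda>n. \<bar>coord e n x\<bar>) \<subseteq> insert 0 ((\<lambda>n. \<bar>coord e n x\<bar>) ` bsupp e x)"
    by (auto simp: bsupp_def)
  ultimately show ?thesis using fin_suppD by (meson bdd_above_finite finite.insertI finite_imageI finite_subset)
qed

lemma coord_le_coord_sup: "x \<in> fin_supp e \<Longrightarrow> \<bar>coord e n x\<bar> \<le> coord_sup e x"
  unfolding coord_sup_def by (rule cSUP_upper) (auto intro: bdd_above_coord)

lemma coord_sup_le: "(\<And>n. \<bar>coord e n x\<bar> \<le> t) \<Longrightarrow> coord_sup e x \<le> t"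
  unfolding coord_sup_def by (rule cSUP_least) auto

section \<open>Greedy sums and the best approximation error\<close>

text \<open>All that is later needed of the greedy ordering: the set of its first \<open>m\<close>
  indices and the fact that no modulus outside this set exceeds one inside it.\<close>

lemma finite_greedy_set:
  "\<exists>A. finite A \<and> card A = m \<and> greedy_sum e m x = comb (\<lambda>n. coord e n x) A \<and>
     (\<forall>i\<in>A. \<forall>j. j \<notin> A \<longrightarrow> \<bar>coord e j x\<bar> \<le> \<bar>coord e i x\<bar>)"
proof -
  define \<rho> where "\<rho> = (SOME \<rho>. greedy_ordering e x \<rho>)"
  have "\<exists>\<rho>. greedy_ordering e x \<rho>"
    using ex_decreasing_enumeration[of "\<lambda>n. \<bar>coord e n x\<bar>"] finite_large_coord
    by (simp add: greedy_ordering_def bsupp_def)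
  then have \<rho>: "greedy_ordering e x \<rho>" unfolding \<rho>_def by (rule someI_ex)
  then have inj: "inj \<rho>" by (simp add: greedy_ordering_def)
  show ?thesis
  proof (intro exI conjI ballI allI impI)
    show "finite (\<rho> ` {..<m})" by simp
    show "card (\<rho> ` {..<m}) = m" using inj by (simp add: card_image inj_on_subset[OF inj])
    show "greedy_sum e m x = comb (\<lambda>n. coord e n x) (\<rho> ` {..<m})"
      unfolding greedy_sum_def \<rho>_def[symmetric] Let_def comb_def
      using inj by (simp add: sum.reindex inj_on_subset[OF inj])
    fix i j assume i: "i \<in> \<rho> ` {..<m}" and j: "j \<notin> \<rho> ` {..<m}"
    then obtain p where p: "p < m" "i = \<rho> p" by blast
    show "\<bar>coord e j x\<bar> \<le> \<bar>coord e i x\<bar>"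
    \<comment> \<open>The ordering need not reach an index with zero coordinate, but there the
      inequality is trivial.\<close>
    proof (cases "coord e j x = 0")
      case False
      then obtain q where "j = \<rho> q" using \<rho> by (auto simp: greedy_ordering_def bsupp_def)
      with j p have "p < q" by (metis imageI leI lessThan_iff order_le_less_trans)
      with \<rho> have "\<bar>coord e (\<rho> q) x\<bar> < \<bar>coord e (\<rho> p) x\<bar> \<or> \<bar>coord e (\<rho> p) x\<bar> = \<bar>coord e (\<rho> q) x\<bar>"
        unfolding greedy_ordering_def by blast
      with p \<open>j = \<rho> q\<close> show ?thesis by auto
    qed simp
  qed
qed

text \<open>Strict dominance of the coefficients on \<open>A\<close> leaves no choice: another set
  of the same size would miss some element of \<open>A\<close> in favour of an index with a smaller
  coefficient.\<close>

lemma greedy_sum_comb: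
  assumes T: "finite T" and A: "A \<subseteq> T"
    and gt: "\<And>i j. i \<in> A \<Longrightarrow> j \<in> T - A \<Longrightarrow> \<bar>a j\<bar> < \<bar>a i\<bar>" and nz: "\<And>i. i \<in> A \<Longrightarrow> a i \<noteq> 0"
  shows "greedy_sum e (card A) (comb a T) = comb a A"
proof -
  obtain G where G: "finite G" "card G = card A"
      "greedy_sum e (card A) (comb a T) = comb (\<lambda>n. coord e n (comb a T)) G"
      "\<forall>i\<in>G. \<forall>j. j \<notin> G \<longrightarrow> \<bar>coord e j (comb a T)\<bar> \<le> \<bar>coord e i (comb a T)\<bar>"
    using finite_greedy_set[of "card A" "comb a T"] by metis
  have finA: "finite A" using T A finite_subset by blast
  have "G = A"
  proof (rule ccontr)
    assume "G \<noteq> A"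
    then have "\<not> A \<subseteq> G" "\<not> G \<subseteq> A"
      using card_subset_eq[OF G(1)] card_subset_eq[OF finA] G(2) by auto
    then obtain i j where i: "i \<in> A" "i \<notin> G" and j: "j \<in> G" "j \<notin> A" by blast
    have "\<bar>a i\<bar> \<le> \<bar>if j \<in> T then a j else 0\<bar>"
      using G(4)[rule_format, OF j(1) i(2)] i(1) A T by (auto simp: coord_comb)
    then show False using gt[of i j] nz[of i] i j by (auto split: if_splits)
  qed
  with G(3) A T show ?thesis by (auto simp: coord_comb intro!: comb_cong)
qed

lemma best_approx_error_le:
  assumes "finite B" shows "best_approx_error e (card B) x \<le> norm (x - comb b B)"
proof -
  have "best_approx_error e (card B) x \<le> infdist x (span (e ` B))"
    unfolding best_approx_error_def using assms
    by (intro cINF_lower) (auto intro!: bdd_belowI[of _ 0] infdist_nonneg)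
  also have "comb b B \<in> span (e ` B)"
    unfolding comb_def by (intro span_sum span_scale span_base) auto
  then have "infdist x (span (e ` B)) \<le> norm (x - comb b B)"
    by (metis infdist_le dist_norm)
  finally show ?thesis .
qed

text \<open>It suffices to test the approximants \<open>comb b B\<close>, since by induction on the
  span these are all linear combinations of the basis vectors indexed by \<open>B\<close>.\<close>

lemma best_approx_error_ge:
  assumes "\<And>B b. finite B \<Longrightarrow> card B = m \<Longrightarrow> r \<le> norm (x - comb b B)"
  shows "r \<le> best_approx_error e m x"
  unfolding best_approx_error_def
proof (rule cINF_greatest)
  have "{..<m} \<in> {A. finite A \<and> card A = m}" by simp
  then show "{A. finite A \<and> card A = m} \<noteq> ({} :: nat set set)" by blast
  fix B :: "nat set" assume B: "B \<in> {A. finite A \<and> card A = m}"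
  have "r \<le> dist x v" if v: "v \<in> span (e ` B)" for v
  proof -
    have "\<exists>b. v = comb b B"
      using v
    proof (induction rule: span_induct_alt)
      case base
      show ?case by (rule exI[of _ "\<lambda>_. 0"]) (simp add: comb_def)
    next
      case (step c y z)
      then obtain n b where n: "n \<in> B" "y = e n" "z = comb b B" by blast
      then have "c *\<^sub>R y + z = comb (\<lambda>k. (if k = n then c else 0) + b k) B"
        using B by (simp add: comb_def scaleR_add_left sum.distrib if_distrib[of "\<lambda>t. t *\<^sub>R _"] cong: if_cong)
      then show ?case by blast
    qed
    then show ?thesis using assms B by (auto simp: dist_norm)
  qed
  then show "r \<le> infdist x (span (e ` B))"
    using span_zero by (subst infdist_notempty) (blast intro!: cINF_greatest)+
qed

section \<open>From greediness to suppression and exchange\<close>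

text \<open>The form in which greediness is applied: the coefficients force the greedy set to be
  \<open>A\<close>, while the competitor \<open>comb b B\<close> is at free disposal.\<close>

lemma greedy_imp_bound:
  assumes "greedy_basis 1 e" "finite T" "A \<subseteq> T"
    and "\<And>i j. i \<in> A \<Longrightarrow> j \<in> T - A \<Longrightarrow> \<bar>a j\<bar> < \<bar>a i\<bar>" "\<And>i. i \<in> A \<Longrightarrow> a i \<noteq> 0"
    and B: "finite B" "card B = card A"
  shows "norm (comb a (T - A)) \<le> norm (comb a T - comb b B)"
\<comment> \<open>Greediness concerns \<open>m \<ge> 1\<close>, so the empty greedy set is treated
  apart; then \<open>B\<close> is empty too.\<close>
proof (cases "A = {}")
  case True
  then show ?thesis using B by (auto simp: comb_def)
next
  case False
  have "finite A" using assms finite_subset by blast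
  with False have "card A \<ge> 1" by (simp add: Suc_leI card_gt_0_iff)
  then have "norm (comb a T - greedy_sum e (card A) (comb a T)) \<le> best_approx_error e (card A) (comb a T)"
    using assms(1) by (simp add: greedy_basis_def)
  also have "\<dots> \<le> norm (comb a T - comb b B)"
    using best_approx_error_le[OF B(1)] B(2) by simp
  finally show ?thesis using greedy_sum_comb[OF assms(2-5)] comb_Diff[OF assms(2,3)] by simp
qed

text \<open>Raising the coefficients on \<open>T - S\<close> to a large constant \<open>k\<close>
  makes this the greedy set, with residual \<open>comb a S\<close>. The competitor with coefficients
  \<open>k - a n\<close> on the same set undoes the change and has residual
  \<open>comb a T\<close>.\<close>

lemma greedy_imp_suppressing:
  assumes "greedy_basis 1 e" shows suppressing
  unfolding suppressing_def
proof (intro allI impI)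
  fix S T :: "nat set" and a :: "nat \<Rightarrow> real" assume T: "finite T" "S \<subseteq> T"
  \<comment> \<open>The summand 1 makes \<open>k\<close> positive and strictly larger than every
    modulus.\<close>
  define k where "k = (\<Sum>n\<in>T. \<bar>a n\<bar>) + 1"
  have k: "\<bar>a n\<bar> < k" if "n \<in> T" for n
    using member_le_sum[of n T "\<lambda>n. \<bar>a n\<bar>"] that T by (simp add: k_def)
  have k0: "0 < k" by (simp add: k_def add_nonneg_pos sum_nonneg)
  define A where "A = T - S"
  define a' where "a' n = (if n \<in> A then k else a n)" for n
  have TA: "T = S \<union> A" "S \<inter> A = {}" "finite S" "finite A" "T - A = S"
    using T by (auto simp: A_def intro: finite_subset)
  have "norm (comb a' (T - A)) \<le> norm (comb a' T - comb (\<lambda>n. k - a n) A)"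
    using assms T(1) k k0 by (intro greedy_imp_bound) (auto simp: a'_def A_def)
  also have "comb a' T - comb (\<lambda>n. k - a n) A = comb a T"
  proof -
    have "comb a' S = comb a S" "comb a' A = comb (\<lambda>n. k) A"
      by (auto simp: a'_def A_def intro: comb_cong)
    then show ?thesis
      using TA by (simp add: comb_Un) (simp add: comb_def scaleR_diff_left sum_subtractf)
  qed
  also have "comb a' (T - A) = comb a S"
    unfolding TA(5) by (rule comb_cong) (auto simp: a'_def A_def)
  finally show "norm (comb a S) \<le> norm (comb a T)" .
qed

text \<open>In the sum over \<open>S \<union> D \<union> B\<close>, enlarging the coefficients on
  \<open>B\<close> by the factor \<open>1 + d\<close> makes \<open>B\<close> the greedy set. Its
  residual lives on \<open>S \<union> D\<close>, whereas the competitor removing \<open>D\<close>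
  leaves the sum over \<open>S \<union> B\<close> up to an error of order \<open>d\<close>. Then
  \<open>d\<close> tends to 0.\<close>

lemma greedy_imp_exchange:
  assumes "greedy_basis 1 e" shows exchange
proof (rule exchangeI)
  fix S D B :: "nat set" and a :: "nat \<Rightarrow> real" and t :: real
  assume fin: "finite S" "finite D" "finite B"
    and dj: "S \<inter> D = {}" "S \<inter> B = {}" "D \<inter> B = {}" and card: "card D = card B"
    and le: "\<And>n. n \<in> S \<union> D \<Longrightarrow> \<bar>a n\<bar> \<le> t" and eq: "\<And>n. n \<in> B \<Longrightarrow> \<bar>a n\<bar> = t"
    and t: "0 < t" and ne: "D \<noteq> {}"
  show "norm (comb a (S \<union> D)) \<le> norm (comb a (S \<union> B))"
  proof -
    have step: "norm (comb a (S \<union> D)) \<le> norm (comb a (S \<union> B)) + d * norm (comb a B)" if d: "d > 0" for d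
    proof -
      \<comment> \<open>The factor breaks possible ties at height \<open>t\<close> between
        \<open>B\<close> and \<open>S \<union> D\<close>.\<close>
      define a' where "a' n = (if n \<in> B then (1 + d) * a n else a n)" for n
      have sD: "comb a' S = comb a S" "comb a' D = comb a D"
        using dj by (auto simp: a'_def intro!: comb_cong)
      have sB: "comb a' B = (1 + d) *\<^sub>R comb a B"
        unfolding comb_scale[symmetric] by (rule comb_cong) (simp add: a'_def)
      have "norm (comb a' (S \<union> D \<union> B - B)) \<le> norm (comb a' (S \<union> D \<union> B) - comb a' D)"
      proof (rule greedy_imp_bound[OF assms])
        fix i j assume i: "i \<in> B" and j: "j \<in> S \<union> D \<union> B - B"
        have "\<bar>a j\<bar> \<le> t" "\<bar>a i\<bar> = t" using i j le eq by auto
        moreover have "t < (1 + d) * t" using d t by (simp add: algebra_simps)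
        ultimately show "\<bar>a' j\<bar> < \<bar>a' i\<bar>" using i j d by (simp add: a'_def abs_mult)
      next
        fix i assume "i \<in> B"
        then show "a' i \<noteq> 0" using eq[of i] t d by (auto simp: a'_def)
      qed (use fin card in auto)
      moreover have "S \<union> D \<union> B - B = S \<union> D" using dj by auto
      moreover have "comb a' (S \<union> D \<union> B) = comb a S + comb a D + (1 + d) *\<^sub>R comb a B"
        using fin dj sD sB by (subst comb_Un comb_Un[of S]; auto)+
      moreover have "comb a' (S \<union> D) = comb a (S \<union> D)"
        using fin dj sD by (simp add: comb_Un)
      moreover have "comb a (S \<union> B) = comb a S + comb a B"
        using fin dj by (simp add: comb_Un)
      ultimately have "norm (comb a (S \<union> D)) \<le> norm (comb a (S \<union> B) + d *\<^sub>R comb a B)"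
        using sD by (simp add: algebra_simps)
      also have "\<dots> \<le> norm (comb a (S \<union> B)) + d * norm (comb a B)"
        using norm_triangle_ineq[of "comb a (S \<union> B)" "d *\<^sub>R comb a B"] d by simp
      finally show ?thesis .
    qed
    have "((\<lambda>d. norm (comb a (S \<union> B)) + d * norm (comb a B)) \<longlongrightarrow> norm (comb a (S \<union> B)) + 0 * norm (comb a B)) (at_right 0)"
      by (intro tendsto_intros)
    then have "norm (comb a (S \<union> D)) \<le> norm (comb a (S \<union> B)) + 0 * norm (comb a B)"
      by (rule tendsto_lowerbound) (use step in \<open>auto simp: eventually_at_filter\<close>)
    then show ?thesis by simp
  qed
qed

section \<open>From suppression and exchange to greediness\<close>

text \<open>Coefficients are shrunk one at a time. Multiplying the coefficient at \<open>k\<close>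
  by \<open>c k\<close> gives a convex combination of the old vector and the vector with that term
  deleted, and neither exceeds the old norm.\<close>

lemma suppressing_contract:
  assumes sup: suppressing and S: "finite S" and c: "\<And>n. n \<in> S \<Longrightarrow> 0 \<le> c n \<and> c n \<le> 1"
  shows "norm (comb (\<lambda>n. c n * a n) S) \<le> norm (comb a S)"
proof -
  have "norm (comb (\<lambda>n. (if n \<in> F then c n else 1) * a n) S) \<le> norm (comb a S)"
    if "finite F" "F \<subseteq> S" for F
    using that
  proof (induction F rule: finite_induct)
    case empty
    then show ?case by simp
  next
    case (insert k F)
    let ?b = "\<lambda>n. (if n \<in> F then c n else 1) * a n"
    let ?b' = "\<lambda>n. (if n \<in> insert k F then c n else 1) * a n"
    have kS: "k \<in> S" using insert by simp
    have rm: "comb f S = f k *\<^sub>R e k + comb f (S - {k})" for f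
      using S kS by (simp add: comb_def sum.remove)
    have "comb ?b' (S - {k}) = comb ?b (S - {k})" by (rule comb_cong) auto
    then have "comb ?b' S = c k *\<^sub>R comb ?b S + (1 - c k) *\<^sub>R comb ?b (S - {k})"
      using insert(2) unfolding rm by (simp add: algebra_simps)
    then have "norm (comb ?b' S) \<le> c k * norm (comb ?b S) + (1 - c k) * norm (comb ?b (S - {k}))"
      using norm_triangle_ineq[of "c k *\<^sub>R comb ?b S" "(1 - c k) *\<^sub>R comb ?b (S - {k})"] c[OF kS] by simp
    also have "\<dots> \<le> c k * norm (comb ?b S) + (1 - c k) * norm (comb ?b S)"
      using c[OF kS] suppressingD[OF sup S, of "S - {k}" ?b] by (intro add_left_mono mult_left_mono) auto
    also have "\<dots> = norm (comb ?b S)" by (simp add: algebra_simps)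
    finally show ?case using insert by simp
  qed
  from this[of S] S have "norm (comb (\<lambda>n. (if n \<in> S then c n else 1) * a n) S) \<le> norm (comb a S)" by simp
  moreover have "comb (\<lambda>n. (if n \<in> S then c n else 1) * a n) S = comb (\<lambda>n. c n * a n) S"
    by (rule comb_cong) simp
  ultimately show ?thesis by simp
qed

text \<open>Dominance of \<open>A\<close> is assumed only in the weak sense, so the estimate applies
  to the set selected by the greedy ordering whatever ties occur.\<close>

lemma greedy_bound_finite:
  assumes sup: suppressing and ex: exchange
    and T: "finite T" "A \<subseteq> T" "B \<subseteq> T" and card: "card A = card B"
    and ge: "\<And>i j. i \<in> A \<Longrightarrow> j \<in> T - A \<Longrightarrow> \<bar>a j\<bar> \<le> \<bar>a i\<bar>"
  shows "norm (comb a (T - A)) \<le> norm (comb a T - comb b B)"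
proof (cases "A = {}")
  case True
  then have "B = {}" using card T by (metis card.empty card_0_eq finite_subset)
  then show ?thesis using True by (simp add: comb_def)
next
  case False
  have fin: "finite A" "finite B" using T finite_subset by blast+
  \<comment> \<open>The height \<open>t\<close> separates the moduli on \<open>A\<close> from those
    on \<open>T - A\<close>.\<close>
  define t where "t = Min ((\<lambda>n. \<bar>a n\<bar>) ` A)"
  have t_le: "t \<le> \<bar>a n\<bar>" if "n \<in> A" for n using that fin by (simp add: t_def)
  have "t \<in> (\<lambda>n. \<bar>a n\<bar>) ` A" unfolding t_def using fin False by (intro Min_in) auto
  then have t_ge: "\<bar>a j\<bar> \<le> t" if "j \<in> T - A" for j using ge that by auto
  have t0: "0 \<le> t" using \<open>t \<in> _\<close> by auto
  define S where "S = T - (A \<union> B)"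
  \<comment> \<open>These factors flatten the coefficients on \<open>A\<close> to modulus exactly
    \<open>t\<close>, keeping signs. Where \<open>a n = 0\<close>, also \<open>t = 0\<close>, and
    the factor 1 does no harm.\<close>
  define c where "c n = (if n \<in> A then (if a n = 0 then 1 else t / \<bar>a n\<bar>) else 1)" for n
  have c: "0 \<le> c n \<and> c n \<le> 1" for n using t0 t_le[of n] by (auto simp: c_def)
  have card': "card (B - A) = card (A - B)"
    using card fin by (metis Int_commute card_Diff_subset_Int finite_Int)
  have comb_c: "comb (\<lambda>n. c n * a n) (T - A) = comb a (T - A)"
    by (rule comb_cong) (simp add: c_def)
  have "T - A = S \<union> (B - A)" using T by (auto simp: S_def)
  then have "norm (comb a (T - A)) = norm (comb (\<lambda>n. c n * a n) (S \<union> (B - A)))"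
    using comb_c by simp
  also have "\<dots> \<le> norm (comb (\<lambda>n. c n * a n) (S \<union> (A - B)))"
  proof (rule exchangeD[OF ex])
    show "\<bar>c n * a n\<bar> \<le> t" if "n \<in> S \<union> (B - A)" for n
      using that t_ge[of n] T by (auto simp: c_def S_def)
    show "\<bar>c n * a n\<bar> = t" if "n \<in> A - B" for n
      using that t_le[of n] t0 by (auto simp: c_def abs_mult)
  qed (use card' fin T in \<open>auto simp: S_def\<close>)
  also have "\<dots> \<le> norm (comb a (S \<union> (A - B)))"
    using c T fin by (intro suppressing_contract[OF sup]) (auto simp: S_def)
  also have "S \<union> (A - B) = T - B" using T by (auto simp: S_def)
  also have "norm (comb a (T - B)) \<le> norm (comb a T - comb b B)"
  proof -
    \<comment> \<open>The approximation error is itself a combination over \<open>T\<close> that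
      agrees with \<open>a\<close> off \<open>B\<close>, so deleting \<open>B\<close> can only
      decrease its norm.\<close>
    let ?d = "\<lambda>n. a n - (if n \<in> B then b n else 0)"
    have "comb ?d T = comb a T - comb (\<lambda>n. if n \<in> B then b n else 0) T"
      by (simp add: comb_def scaleR_diff_left sum_subtractf)
    also have "comb (\<lambda>n. if n \<in> B then b n else 0) T = comb (\<lambda>n. if n \<in> B then b n else 0) B"
      using T by (intro comb_mono_neutral[symmetric]) auto
    also have "\<dots> = comb b B" by (rule comb_cong) simp
    moreover have "comb ?d (T - B) = comb a (T - B)" by (rule comb_cong) simp
    ultimately show ?thesis using suppressingD[OF sup T(1), of "T - B" ?d] by auto
  qed
  finally show ?thesis .
qed

lemma greedy_iff: "greedy_basis 1 e \<longleftrightarrow> suppressing \<and> exchange"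
proof
  assume "suppressing \<and> exchange"
  then have sup: suppressing and ex: exchange by auto
  show "greedy_basis 1 e"
    unfolding greedy_basis_def
  proof (intro allI impI)
    fix x and m :: nat
    let ?c = "\<lambda>n. coord e n x"
    obtain A where A: "finite A" "card A = m" "greedy_sum e m x = comb ?c A"
        "\<forall>i\<in>A. \<forall>j. j \<notin> A \<longrightarrow> \<bar>?c j\<bar> \<le> \<bar>?c i\<bar>"
      using finite_greedy_set[of m x] by metis
    have "norm (x - comb ?c A) \<le> norm (x - comb b B)" if B: "finite B" "card B = m" for B b
    proof (rule LIMSEQ_le)
      have lim: "(\<lambda>N. comb ?c {..<N}) \<longlonglongrightarrow> x"
        using coord_sums[of x] by (simp add: sums_def comb_def)
      show "(\<lambda>N. norm (comb ?c {..<N} - comb ?c A)) \<longlonglongrightarrow> norm (x - comb ?c A)"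
        by (intro tendsto_intros lim)
      show "(\<lambda>N. norm (comb ?c {..<N} - comb b B)) \<longlonglongrightarrow> norm (x - comb b B)"
        by (intro tendsto_intros lim)
      \<comment> \<open>From \<open>N0\<close> on, the partial sums of \<open>x\<close> involve all
        of \<open>A\<close> and \<open>B\<close>, so the finite estimate applies to them.\<close>
      obtain N0 where N0: "\<forall>i\<in>A \<union> B. i < N0"
        using A(1) B(1) finite_nat_set_iff_bounded by (metis finite_UnI)
      have "norm (comb ?c {..<N} - comb ?c A) \<le> norm (comb ?c {..<N} - comb b B)" if "N \<ge> N0" for N
      proof -
        have sub: "A \<subseteq> {..<N}" "B \<subseteq> {..<N}" using N0 that by (auto dest: bspec)
        then show ?thesis
          using greedy_bound_finite[OF sup ex _ sub, of ?c b] A B by (simp add: comb_Diff)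
      qed
      then show "\<exists>N. \<forall>n\<ge>N. norm (comb ?c {..<n} - comb ?c A) \<le> norm (comb ?c {..<n} - comb b B)"
        by blast
    qed
    then show "norm (x - greedy_sum e m x) \<le> 1 * best_approx_error e m x"
      using A(3) best_approx_error_ge by simp
  qed
qed (use greedy_imp_suppressing greedy_imp_exchange in blast)

text \<open>For \<open>z = 0\<close> the set \<open>Gamma_set e z\<close> contains every finitely
  supported vector, so after scaling the coefficients on \<open>S\<close> into
  \<open>[-1, 1]\<close> any disjoint remainder may be taken as \<open>y\<close>.\<close>

lemma Q_star_imp_suppressing:
  assumes "property_Q_star 1 e" shows suppressing
  unfolding suppressing_def
proof (intro allI impI)
  fix S T :: "nat set" and a :: "nat \<Rightarrow> real" assume T: "finite T" "S \<subseteq> T"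
  then have fin: "finite S" "finite (T - S)" using finite_subset by auto
  define k where "k = (\<Sum>n\<in>S. \<bar>a n\<bar>) + 1"
  have k: "\<bar>a n\<bar> \<le> k" if "n \<in> S" for n
    using member_le_sum[of n S "\<lambda>n. \<bar>a n\<bar>"] that fin by (simp add: k_def)
  have k0: "0 < k" by (simp add: k_def add_nonneg_pos sum_nonneg)
  let ?b = "\<lambda>n. (1 / k) * a n"
  have "\<bar>coord e n (comb ?b S)\<bar> \<le> 1" for n
    using k[of n] k0 fin by (simp add: coord_comb abs_mult)
  then have "coord_sup e (comb ?b S) \<le> 1" "coord_sup e 0 \<le> 1"
    by (auto intro!: coord_sup_le)
  moreover have "disj e (comb ?b S) 0" "disj e (comb ?b S) (comb ?b (T - S))"
    using fin by (auto simp: disj_def bsupp_comb) (simp add: bsupp_def)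
  moreover have "0 \<in> fin_supp e" by (simp add: fin_supp_def bsupp_def)
  moreover have "comb ?b (T - S) \<in> Gamma_set e 0" using fin by (simp add: Gamma_set_def)
  ultimately have "norm (comb ?b S + 0) \<le> 1 * norm (comb ?b S + comb ?b (T - S))"
    using assms[unfolded property_Q_star_def, rule_format, of "comb ?b S" 0 "comb ?b (T - S)"] fin
    by simp
  also have "comb ?b S + comb ?b (T - S) = comb ?b T" using T by (simp add: comb_Diff)
  finally show "norm (comb a S) \<le> norm (comb a T)"
    unfolding comb_scale using k0 by (simp add: divide_le_cancel)
qed

text \<open>Division by \<open>t\<close> turns the coefficients on \<open>B\<close> into unimodular
  ones, so that the combination over \<open>B\<close> is an admissible \<open>y\<close> for the
  combination over \<open>D\<close> as \<open>z\<close>.\<close>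

lemma Q_star_imp_exchange:
  assumes "property_Q_star 1 e" shows exchange
proof (rule exchangeI)
  fix S D B :: "nat set" and a :: "nat \<Rightarrow> real" and t :: real
  assume fin: "finite S" "finite D" "finite B"
    and dj: "S \<inter> D = {}" "S \<inter> B = {}" "D \<inter> B = {}" and card: "card D = card B"
    and le: "\<And>n. n \<in> S \<union> D \<Longrightarrow> \<bar>a n\<bar> \<le> t" and eq: "\<And>n. n \<in> B \<Longrightarrow> \<bar>a n\<bar> = t"
    and t: "0 < t" and ne: "D \<noteq> {}"
  show "norm (comb a (S \<union> D)) \<le> norm (comb a (S \<union> B))"
  proof -
    let ?b = "\<lambda>n. (1 / t) * a n"
    have "coord_sup e (comb ?b S) \<le> 1" "coord_sup e (comb ?b D) \<le> 1"
      using le t fin by (auto intro!: coord_sup_le simp: coord_comb)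
    moreover have "disj e (comb ?b S) (comb ?b D)" "disj e (comb ?b S) (comb ?b B)"
      "disj e (comb ?b D) (comb ?b B)"
      using fin dj by (auto simp: disj_def bsupp_comb)
    moreover have "card (bsupp e (comb ?b D)) \<le> card {n. \<bar>coord e n (comb ?b B)\<bar> = 1}"
    proof -
      have "{n. \<bar>coord e n (comb ?b B)\<bar> = 1} = B"
        using fin eq t by (auto simp: coord_comb abs_mult split: if_splits)
      \<comment> \<open>Coefficients on \<open>D\<close> may vanish, so the support can be smaller
        than \<open>D\<close>.\<close>
      moreover have "card (bsupp e (comb ?b D)) \<le> card D"
        using fin by (intro card_mono) (auto simp: bsupp_comb)
      ultimately show ?thesis using card by simp
    qed
    ultimately have "norm (comb ?b S + comb ?b D) \<le> 1 * norm (comb ?b S + comb ?b B)"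
      using assms[unfolded property_Q_star_def, rule_format, of "comb ?b S" "comb ?b D" "comb ?b B"] fin
      by (simp add: Gamma_set_def)
    then have "norm (comb ?b (S \<union> D)) \<le> norm (comb ?b (S \<union> B))"
      using fin dj by (simp only: comb_Un mult_1)
    then show ?thesis unfolding comb_scale using t by (simp add: divide_le_cancel)
  qed
qed

lemma Q_star_iff: "property_Q_star 1 e \<longleftrightarrow> suppressing \<and> exchange"
proof
  assume "suppressing \<and> exchange"
  then have sup: suppressing and ex: exchange by auto
  show "property_Q_star 1 e"
    unfolding property_Q_star_def
  proof (intro ballI impI)
    fix x z y
    assume fs: "x \<in> fin_supp e" "z \<in> fin_supp e" "y \<in> fin_supp e"
      and dj: "disj e x z" "disj e x y" and max: "max (coord_sup e x) (coord_sup e z) \<le> 1"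
      and \<Gamma>: "y \<in> Gamma_set e z"
    let ?X = "bsupp e x" and ?Y = "bsupp e y" and ?Z = "bsupp e z"
    have fin: "finite ?X" "finite ?Y" "finite ?Z" using fs fin_suppD by auto
    \<comment> \<open>A single coefficient function represents all three vectors, because their
      supports are disjoint; for \<open>z = 0\<close> the set \<open>?Z\<close> is empty.\<close>
    define a where "a n = (if n \<in> ?X then coord e n x else if n \<in> ?Z then coord e n z else coord e n y)" for n
    have X: "comb a ?X = x"
      using comb_coord[OF fin(1) order.refl] comb_cong[of ?X a "\<lambda>n. coord e n x"] by (simp add: a_def)
    have Z: "comb a ?Z = z"
    proof -
      have "comb a ?Z = comb (\<lambda>n. coord e n z) ?Z"
        using dj by (intro comb_cong) (auto simp: a_def disj_def)
      then show ?thesis using comb_coord[OF fin(3)] by simp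
    qed
    show "norm (x + z) \<le> 1 * norm (x + y)"
    proof (cases "z = 0")
      case True
      then have "?Z = {}" by (simp add: bsupp_def)
      then have Y: "comb a ?Y = y"
      proof -
        have "comb a ?Y = comb (\<lambda>n. coord e n y) ?Y"
          using dj \<open>?Z = {}\<close> by (intro comb_cong) (auto simp: a_def disj_def)
        then show ?thesis using comb_coord[OF fin(2)] by simp
      qed
      have "norm (comb a ?X) \<le> norm (comb a (?X \<union> ?Y))"
        using fin by (intro suppressingD[OF sup]) auto
      then show ?thesis using X Y True fin dj by (simp add: comb_Un disj_def)
    next
      case False
      with \<Gamma> have zy: "?Z \<inter> ?Y = {}" and card: "card ?Z \<le> card {n. \<bar>coord e n y\<bar> = 1}"
        by (auto simp: Gamma_set_def disj_def)
      have Y: "comb a ?Y = y"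
      proof -
        have "comb a ?Y = comb (\<lambda>n. coord e n y) ?Y"
          using dj zy by (intro comb_cong) (auto simp: a_def disj_def)
        then show ?thesis using comb_coord[OF fin(2)] by simp
      qed
      \<comment> \<open>Exchange needs exactly as many unimodular coordinates as \<open>?Z\<close>
        has elements; suppression then accounts for the rest of \<open>y\<close>.\<close>
      obtain B where B: "B \<subseteq> {n. \<bar>coord e n y\<bar> = 1}" "card B = card ?Z"
        using obtain_subset_with_card_n[OF card] by metis
      have BY: "B \<subseteq> ?Y" using B by (auto simp: bsupp_def)
      then have finB: "finite B" using fin finite_subset by blast
      have "norm (comb a (?X \<union> ?Z)) \<le> norm (comb a (?X \<union> B))"
      proof (rule exchangeD[OF ex])
        show "\<bar>a n\<bar> \<le> 1" if "n \<in> ?X \<union> ?Z" for n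
          using that max coord_le_coord_sup[OF fs(1), of n] coord_le_coord_sup[OF fs(2), of n]
          by (auto simp: a_def)
        show "\<bar>a n\<bar> = 1" if "n \<in> B" for n
          using that B BY dj zy by (auto simp: a_def disj_def)
      qed (use fin finB BY dj zy B in \<open>auto simp: disj_def\<close>)
      also have "\<dots> \<le> norm (comb a (?X \<union> ?Y))"
        using fin BY by (intro suppressingD[OF sup]) auto
      finally show ?thesis using X Y Z fin dj by (simp add: comb_Un disj_def)
    qed
  qed
qed (use Q_star_imp_suppressing Q_star_imp_exchange in blast)

section \<open>Suppression unconditionality and finite suppression\<close>

lemma proj_finite:
  assumes "finite S" "\<And>n. n \<in> A \<Longrightarrow> coord e n x \<noteq> 0 \<Longrightarrow> n \<in> S"
  shows "proj e A x = comb (\<lambda>n. coord e n x) (S \<inter> A)"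
proof -
  have "proj e A x = (\<Sum>n\<in>S \<inter> A. proj_term e A x n)"
    unfolding proj_def using assms by (intro suminf_finite) (auto simp: proj_term_def)
  then show ?thesis by (simp add: comb_def proj_term_def)
qed

lemma suppression_unconditional_iff: "suppression_unconditional 1 e \<longleftrightarrow> suppressing"
proof
  assume L: "suppression_unconditional 1 e"
  show suppressing
    unfolding suppressing_def
  proof (intro allI impI)
    fix S T :: "nat set" and a :: "nat \<Rightarrow> real" assume T: "finite T" "S \<subseteq> T"
    have "proj e S (comb a T) = comb (\<lambda>n. coord e n (comb a T)) (T \<inter> S)"
      using T by (intro proj_finite) auto
    also have "\<dots> = comb a S"
      using T by (auto simp: coord_comb Int_absorb1 intro!: comb_cong)
    finally show "norm (comb a S) \<le> norm (comb a T)"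
      using L unfolding suppression_unconditional_def by (metis mult_1)
  qed
next
  assume sup: suppressing
  show "suppression_unconditional 1 e"
    unfolding suppression_unconditional_def
  proof (intro allI)
    fix x A
    let ?g = "\<lambda>n. coord e n x *\<^sub>R e n"
    have le: "norm (sum (proj_term e A x) F) \<le> norm (sum ?g F)" if "finite F" for F
    proof -
      have "sum (proj_term e A x) F = comb (\<lambda>n. coord e n x) (F \<inter> A)"
        unfolding comb_def proj_term_def using that by (simp add: sum.inter_restrict)
      then show ?thesis
        using suppressingD[OF sup that, of "F \<inter> A" "\<lambda>n. coord e n x"] by (simp add: comb_def)
    qed
    have "summable ?g" using coord_sums sums_summable by blast
    \<comment> \<open>Each block of the projected series is dominated in norm by the same block of
      the expansion of \<open>x\<close>, so the Cauchy criterion carries over.\<close>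
    then have s: "summable (proj_term e A x)"
      unfolding summable_Cauchy using le[OF finite_atLeastLessThan] by (meson order_le_less_trans)
    have "norm (proj e A x) \<le> norm x"
    proof (rule LIMSEQ_le)
      show "(\<lambda>N. norm (sum (proj_term e A x) {..<N})) \<longlonglongrightarrow> norm (proj e A x)"
        unfolding proj_def by (intro tendsto_norm summable_LIMSEQ s)
      show "(\<lambda>N. norm (sum ?g {..<N})) \<longlonglongrightarrow> norm x"
        using coord_sums[of x] by (intro tendsto_norm) (simp add: sums_def)
    qed (use le in blast)
    with s show "summable (proj_term e A x) \<and> norm (proj e A x) \<le> 1 * norm x" by simp
  qed
qed

section \<open>Property (A) and exchange\<close>

text \<open>All coefficients moved or given a new sign have modulus \<open>t\<close>, the largest
  one. The passage from \<open>x\<close> to the modified vector is therefore made of exchanges at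
  height \<open>t\<close>.\<close>

lemma exchange_imp_A:
  assumes ex: exchange shows "property_A 1 e"
  unfolding property_A_def Let_def
proof (intro ballI allI impI; elim conjE)
  fix x and \<pi> :: "nat \<Rightarrow> nat" and \<theta> :: "nat \<Rightarrow> real"
  let ?S = "bsupp e x" and ?M = "max_coords e x" and ?a = "\<lambda>n. coord e n x"
  assume x: "x \<in> fin_supp e" and inj: "inj_on \<pi> ?S" and fix_off: "\<forall>j\<in>?S - ?M. \<pi> j = j"
    and \<theta>: "\<forall>n\<in>?M. \<theta> n \<in> {1, -1}" "\<forall>n\<in>?M. \<pi> n = n \<longrightarrow> \<theta> n = 1"
  define t where "t = coord_sup e x"
  have finS: "finite ?S" using x fin_suppD by blast
  have MS: "?M \<subseteq> ?S" by (auto simp: max_coords_def)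
  have aM: "\<bar>?a n\<bar> = t" if "n \<in> ?M" for n using that by (simp add: max_coords_def t_def)
  have a_le: "\<bar>?a n\<bar> \<le> t" for n using coord_le_coord_sup[OF x] by (simp add: t_def)
  have t0: "0 \<le> t" using a_le[of 0] by linarith
  \<comment> \<open>Only the positions that really move are exchanged; at the fixed ones the sign is
    1 and the term stays as it is.\<close>
  define M2 where "M2 = {n\<in>?M. \<pi> n \<noteq> n}"
  define S0 where "S0 = ?S - M2"
  have S0: "\<pi> n = n" if "n \<in> S0" for n using that fix_off by (auto simp: S0_def M2_def)
  have split: "?S = S0 \<union> M2" "S0 \<inter> M2 = {}" "S0 \<subseteq> ?S" "M2 \<subseteq> ?S" using MS by (auto simp: S0_def M2_def)
  have fin: "finite S0" "finite M2" using finS split finite_subset by blast+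
  define B where "B = \<pi> ` M2"
  have inj2: "inj_on \<pi> M2" using inj split(4) inj_on_subset by blast
  have BS0: "S0 \<inter> B = {}"
  proof -
    have "\<pi> ` S0 \<inter> \<pi> ` M2 = {}"
      using inj_on_image_Int[OF inj split(3,4)] split(2) by simp
    moreover have "\<pi> ` S0 = S0" using S0 by force
    ultimately show ?thesis by (simp add: B_def)
  qed
  \<comment> \<open>\<open>B\<close> and \<open>M2\<close> may overlap, so the exchange goes through a fresh set \<open>D\<close>.\<close>
  obtain D where D: "finite D" "card D = card M2" "D \<inter> (?S \<union> B) = {}"
  proof -
    have "infinite (- (?S \<union> B))" using finS fin by (simp add: B_def Compl_eq_Diff_UNIV Diff_infinite_finite)
    then obtain D where "finite D" "card D = card M2" "D \<subseteq> - (?S \<union> B)"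
      using infinite_arbitrarily_large by blast
    then show ?thesis using that by blast
  qed
  \<comment> \<open>Two coefficient functions are needed because \<open>M2\<close> and
    \<open>B\<close> may share indices: \<open>c\<close> has the coordinates of \<open>x\<close>
    there and \<open>b\<close> the new ones. They agree on \<open>S0 \<union> D\<close>, where the
    two exchanges meet.\<close>
  define b where "b n = (if n \<in> B then \<theta> (the_inv_into M2 \<pi> n) * ?a (the_inv_into M2 \<pi> n)
      else if n \<in> D then t else ?a n)" for n
  define c where "c n = (if n \<in> D then t else ?a n)" for n
  have bB: "b (\<pi> n) = \<theta> n * ?a n" if "n \<in> M2" for n
    using that inj2 by (simp add: b_def B_def the_inv_into_f_f)
  have "norm x = norm (comb c (S0 \<union> M2))"
  proof -
    have "comb c ?S = comb ?a ?S" using D by (intro comb_cong) (auto simp: c_def)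
    then show ?thesis using comb_coord[OF finS] split(1) by simp
  qed
  also have "\<dots> \<le> norm (comb c (S0 \<union> D))"
  proof (rule exchangeD[OF ex])
    show "\<bar>c n\<bar> \<le> t" for n using a_le t0 by (simp add: c_def)
    show "\<bar>c n\<bar> = t" if "n \<in> D" for n using that t0 by (simp add: c_def)
  qed (use fin D split in auto)
  also have "comb c (S0 \<union> D) = comb b (S0 \<union> D)"
    using D BS0 by (intro comb_cong) (auto simp: c_def b_def)
  also have "norm (comb b (S0 \<union> D)) \<le> norm (comb b (S0 \<union> B))"
  proof (rule exchangeD[OF ex])
    show "\<bar>b n\<bar> \<le> t" if "n \<in> S0 \<union> D" for n using that a_le t0 BS0 D by (auto simp: b_def)
    show "\<bar>b n\<bar> = t" if "n \<in> B" for n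
    proof -
      from that obtain k where k: "k \<in> M2" "n = \<pi> k" by (auto simp: B_def)
      then have "\<bar>\<theta> k\<bar> = 1" "\<bar>?a k\<bar> = t" using \<theta>(1) aM by (auto simp: M2_def)
      then show ?thesis using bB k by (simp add: abs_mult)
    qed
    show "card D = card B" using D inj2 by (simp add: B_def card_image)
  qed (use fin D split BS0 in \<open>auto simp: B_def\<close>)
  also have "comb b (S0 \<union> B) = (\<Sum>n\<in>?M. (\<theta> n * ?a n) *\<^sub>R e (\<pi> n)) + (x - proj e ?M x)"
  proof -
    let ?M1 = "?M - M2"
    have finM: "finite ?M" using MS finS finite_subset by blast
    have "(\<Sum>n\<in>?M. (\<theta> n * ?a n) *\<^sub>R e (\<pi> n)) =
        (\<Sum>n\<in>?M1. (\<theta> n * ?a n) *\<^sub>R e (\<pi> n)) + (\<Sum>n\<in>M2. (\<theta> n * ?a n) *\<^sub>R e (\<pi> n))"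
      using finM by (intro sum.subset_diff) (auto simp: M2_def)
    also have "(\<Sum>n\<in>?M1. (\<theta> n * ?a n) *\<^sub>R e (\<pi> n)) = comb ?a ?M1"
      unfolding comb_def using \<theta>(2) by (intro sum.cong) (auto simp: M2_def)
    also have "(\<Sum>n\<in>M2. (\<theta> n * ?a n) *\<^sub>R e (\<pi> n)) = comb b B"
      unfolding comb_def B_def using inj2 bB by (simp add: sum.reindex)
    also have "x - proj e ?M x = comb ?a (?S - ?M)"
    proof -
      have "proj e ?M x = comb ?a (?S \<inter> ?M)" using finS by (intro proj_finite) (auto simp: bsupp_def)
      also have "?S \<inter> ?M = ?M" using MS by auto
      finally show ?thesis using comb_coord[OF finS] comb_Diff[OF finS MS] by simp
    qed
    ultimately have "(\<Sum>n\<in>?M. (\<theta> n * ?a n) *\<^sub>R e (\<pi> n)) + (x - proj e ?M x)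
        = (comb ?a ?M1 + comb ?a (?S - ?M)) + comb b B"
      by simp
    also have "comb ?a ?M1 + comb ?a (?S - ?M) = comb ?a (?M1 \<union> (?S - ?M))"
      using finM finS by (intro comb_Un[symmetric]) auto
    also have "?M1 \<union> (?S - ?M) = S0" using MS by (auto simp: S0_def M2_def)
    also have "comb ?a S0 = comb b S0"
      using BS0 D split by (intro comb_cong) (auto simp: b_def)
    also have "comb b S0 + comb b B = comb b (S0 \<union> B)"
      using fin BS0 by (intro comb_Un[symmetric]) (auto simp: B_def)
    finally show ?thesis by simp
  qed
  finally show "norm x \<le> 1 * norm ((\<Sum>n\<in>?M. (\<theta> n * ?a n) *\<^sub>R e (\<pi> n)) + (x - proj e ?M x))"
    by simp
qed

text \<open>
  The target \<open>B\<close> may lie beyond the support of \<open>S \<union> D\<close>, where Property (A) does not allow \<open>\<pi>\<close> to go.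
  A small multiple of \<open>e N\<close> with \<open>N\<close> large lifts this restriction.
\<close>

lemma A_imp_exchange_bound:
  assumes A: "property_A 1 e"
    and fin: "finite S" "finite D" "finite B" and ne: "D \<noteq> {}"
    and dj: "S \<inter> D = {}" "S \<inter> B = {}" "D \<inter> B = {}" and card: "card D = card B"
    and le: "\<And>n. n \<in> S \<Longrightarrow> \<bar>b n\<bar> \<le> t" and eq: "\<And>n. n \<in> D \<union> B \<Longrightarrow> \<bar>b n\<bar> = t"
    and N: "\<And>n. n \<in> S \<union> D \<union> B \<Longrightarrow> n < N" and bN: "0 < b N" "b N < t"
  shows "norm (comb b (insert N S \<union> D)) \<le> norm (comb b (insert N S \<union> B))"
proof -
  define S' where "S' = insert N S"
  define x where "x = comb b (S' \<union> D)"
  have t: "0 < t" using bN by simp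
  have finS': "finite S'" using fin by (simp add: S'_def)
  have NSD: "N \<notin> S" "N \<notin> D" "N \<notin> B" using N by blast+
  have dj': "S' \<inter> D = {}" "S' \<inter> B = {}" using dj NSD by (auto simp: S'_def)
  have le': "\<bar>b n\<bar> \<le> t" if "n \<in> S' \<union> D" for n using that le[of n] eq[of n] bN by (auto simp: S'_def)
  have cx: "coord e n x = (if n \<in> S' \<union> D then b n else 0)" for n
    using finS' fin by (simp add: x_def coord_comb)
  have sx: "bsupp e x = {n\<in>S' \<union> D. b n \<noteq> 0}" using finS' fin by (simp add: x_def bsupp_comb)
  have xf: "x \<in> fin_supp e" using finS' fin by (simp add: x_def)
  obtain k where k: "k \<in> D" using ne by blast
  have sup: "coord_sup e x = t"
  proof (rule antisym)
    show "coord_sup e x \<le> t" using le' t by (intro coord_sup_le) (auto simp: cx)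
    show "t \<le> coord_sup e x" using coord_le_coord_sup[OF xf, of k] k eq[of k] by (simp add: cx)
  qed
  \<comment> \<open>\<open>M\<close> contains \<open>D\<close>, and possibly points of
    \<open>S\<close> of modulus \<open>t\<close>, which will be left fixed. It does not contain
    \<open>N\<close>, as \<open>b N < t\<close>.\<close>
  define M where "M = max_coords e x"
  have M: "M = {n\<in>S' \<union> D. \<bar>b n\<bar> = t}" using t by (auto simp: M_def max_coords_def sup sx cx)
  have DM: "D \<subseteq> M" using eq by (auto simp: M)
  have bD: "b n \<noteq> 0" if "n \<in> D" for n using eq[of n] that t by auto
  have finM: "finite M" using fin finS' by (simp add: M)
  have "N \<in> bsupp e x" using bN by (simp add: sx S'_def)
  have x0: "x \<noteq> 0" using \<open>N \<in> bsupp e x\<close> by (auto simp: bsupp_def)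
  \<comment> \<open>This is the purpose of \<open>N\<close>: all of \<open>B\<close> now lies in the
    range permitted to \<open>\<pi>\<close>.\<close>
  have Nmax: "N \<le> Max (bsupp e x)" using \<open>N \<in> bsupp e x\<close> xf fin_suppD by (intro Max_ge) auto
  obtain h where h: "bij_betw h D B" using finite_same_card_bij[OF fin(2,3) card] by blast
  have hB: "h n \<in> B" if "n \<in> D" for n using h that by (auto simp: bij_betw_def)
  define \<pi> where "\<pi> n = (if n \<in> D then h n else n)" for n
  \<comment> \<open>The quotient of two numbers of modulus \<open>t\<close> is the sign that turns
    the coefficient at \<open>n\<close> into the one prescribed at \<open>h n\<close>.\<close>
  define \<theta> where "\<theta> n = (if n \<in> D then b (h n) / b n else 1)" for n
  have "inj_on \<pi> (S' \<union> D)"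
    unfolding inj_on_def \<pi>_def using hB dj' h by (auto simp: bij_betw_def dest: inj_onD)
  then have inj: "inj_on \<pi> (bsupp e x)" by (rule inj_on_subset) (auto simp: sx)
  have ran: "\<pi> ` bsupp e x \<subseteq> {..Max (bsupp e x)}"
  proof -
    have "\<pi> n \<le> N" if "n \<in> S' \<union> D" for n
      using that N[of n] N[of "h n"] hB[of n] by (auto simp: \<pi>_def S'_def intro: less_imp_le)
    then show ?thesis using Nmax by (auto simp: sx intro: order.trans)
  qed
  have \<theta>1: "\<forall>n\<in>M. \<theta> n \<in> {1, -1}"
  proof
    fix n assume "n \<in> M"
    have "\<bar>b (h n) / b n\<bar> = 1" if "n \<in> D" using eq[of n] eq[of "h n"] hB that t by simp
    then show "\<theta> n \<in> {1, -1}" by (auto simp: \<theta>_def abs_if split: if_splits)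
  qed
  have "h n \<noteq> n" if "n \<in> D" for n using hB[OF that] that dj(3) by auto
  then have \<theta>2: "\<forall>n\<in>M. \<pi> n = n \<longrightarrow> \<theta> n = 1" by (simp add: \<pi>_def \<theta>_def)
  have off: "\<forall>j\<in>bsupp e x - M. \<pi> j = j" using DM by (auto simp: \<pi>_def)
  have "norm x \<le> 1 * norm ((\<Sum>n\<in>M. (\<theta> n * coord e n x) *\<^sub>R e (\<pi> n)) + (x - proj e M x))"
    using A[unfolded property_A_def Let_def, rule_format, OF xf x0, folded M_def, of \<pi> \<theta>]
      inj ran \<theta>1 \<theta>2 off by blast
  also have "(\<Sum>n\<in>M. (\<theta> n * coord e n x) *\<^sub>R e (\<pi> n)) + (x - proj e M x) = comb b (S' \<union> B)"
  proof -
    have "(\<Sum>n\<in>M. (\<theta> n * coord e n x) *\<^sub>R e (\<pi> n)) =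
        (\<Sum>n\<in>M - D. (\<theta> n * coord e n x) *\<^sub>R e (\<pi> n)) + (\<Sum>n\<in>D. (\<theta> n * coord e n x) *\<^sub>R e (\<pi> n))"
      using DM finM by (rule sum.subset_diff)
    also have "(\<Sum>n\<in>M - D. (\<theta> n * coord e n x) *\<^sub>R e (\<pi> n)) = comb b (M - D)"
      unfolding comb_def by (rule sum.cong) (auto simp: \<theta>_def \<pi>_def cx M)
    also have "(\<Sum>n\<in>D. (\<theta> n * coord e n x) *\<^sub>R e (\<pi> n)) = (\<Sum>n\<in>D. b (h n) *\<^sub>R e (h n))"
      using bD by (intro sum.cong) (auto simp: \<theta>_def \<pi>_def cx)
    also have "\<dots> = comb b B"
      unfolding comb_def using h by (rule sum.reindex_bij_betw)
    finally have 1: "(\<Sum>n\<in>M. (\<theta> n * coord e n x) *\<^sub>R e (\<pi> n)) = comb b (M - D) + comb b B" .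
    have "proj e M x = comb (\<lambda>n. coord e n x) (M \<inter> M)"
      using finM by (rule proj_finite)
    also have "\<dots> = comb b M" by (auto simp: cx M intro!: comb_cong)
    finally have 2: "x - proj e M x = comb b (S' \<union> D - M)"
      unfolding x_def using finS' fin by (subst comb_Diff) (auto simp: M)
    have "(M - D) \<union> (S' \<union> D - M) = S'" "(M - D) \<inter> (S' \<union> D - M) = {}"
      using DM dj' by (auto simp: M)
    then have "comb b (M - D) + comb b (S' \<union> D - M) = comb b S'"
      using comb_Un[of "M - D" "S' \<union> D - M" b] finM finS' fin by simp
    then show ?thesis unfolding 1 2 using comb_Un[OF finS' fin(3) dj'(2)] by (simp add: algebra_simps)
  qed
  finally show ?thesis by (simp add: x_def S'_def)
qed

text \<open>Suppression allows the coefficients on \<open>D\<close> to be raised to modulus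
  \<open>t\<close> and a term \<open>d *\<^sub>R e N\<close> to be added without lowering the norm
  of the left side. Property (A) then moves \<open>D\<close> to \<open>B\<close>, and the extra term
  disappears as \<open>d\<close> tends to 0.\<close>

lemma A_imp_exchange:
  assumes sup: suppressing and A: "property_A 1 e" shows exchange
proof (rule exchangeI)
  fix S D B :: "nat set" and a :: "nat \<Rightarrow> real" and t :: real
  assume fin: "finite S" "finite D" "finite B"
    and dj: "S \<inter> D = {}" "S \<inter> B = {}" "D \<inter> B = {}" and card: "card D = card B"
    and le: "\<And>n. n \<in> S \<union> D \<Longrightarrow> \<bar>a n\<bar> \<le> t" and eq: "\<And>n. n \<in> B \<Longrightarrow> \<bar>a n\<bar> = t"
    and t: "0 < t" and ne: "D \<noteq> {}"
  show "norm (comb a (S \<union> D)) \<le> norm (comb a (S \<union> B))"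
  proof -
    obtain N where N: "\<forall>n\<in>S \<union> D \<union> B. n < N"
      using fin finite_nat_set_iff_bounded by (metis finite_UnI)
    then have NSD: "N \<notin> S" "N \<notin> D" "N \<notin> B" by blast+
    have step: "norm (comb a (S \<union> D)) \<le> norm (comb a (S \<union> B)) + d * norm (e N)" if d: "0 < d" "d < t" for d
    proof -
      \<comment> \<open>On \<open>D\<close> the signs of \<open>a\<close> are kept, so that
        \<open>a\<close> is recovered from \<open>b\<close> by factors in
        \<open>[0, 1]\<close>.\<close>
      define b where "b n = (if n = N then d else if n \<in> D then (if a n < 0 then - t else t) else a n)" for n
      define c where "c n = (if n \<in> D then \<bar>a n\<bar> / t else 1)" for n
      have "comb a (S \<union> D) = comb (\<lambda>n. c n * b n) (S \<union> D)"
        using NSD t dj by (intro comb_cong) (auto simp: b_def c_def)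
      also have "norm \<dots> \<le> norm (comb b (S \<union> D))"
        using fin le t by (intro suppressing_contract[OF sup]) (auto simp: c_def)
      also have "\<dots> \<le> norm (comb b (insert N S \<union> D))"
        using fin by (intro suppressingD[OF sup]) auto
      also have "\<bar>b n\<bar> = t" if "n \<in> D \<union> B" for n
        using that eq[of n] NSD t by (auto simp: b_def)
      then have "norm (comb b (insert N S \<union> D)) \<le> norm (comb b (insert N S \<union> B))"
        using N NSD dj le d by (intro A_imp_exchange_bound[OF A fin ne dj card, of b t N]) (auto simp: b_def)
      also have "comb b (insert N S \<union> B) = d *\<^sub>R e N + comb a (S \<union> B)"
      proof -
        have "comb b (S \<union> B) = comb a (S \<union> B)" using NSD dj by (intro comb_cong) (auto simp: b_def)
        then show ?thesis using fin NSD by (simp add: comb_def b_def)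
      qed
      also have "norm \<dots> \<le> norm (comb a (S \<union> B)) + d * norm (e N)"
        using norm_triangle_ineq[of "d *\<^sub>R e N" "comb a (S \<union> B)"] d by simp
      finally show ?thesis .
    qed
    have "((\<lambda>d. norm (comb a (S \<union> B)) + d * norm (e N)) \<longlongrightarrow> norm (comb a (S \<union> B)) + 0 * norm (e N)) (at_right 0)"
      by (intro tendsto_intros)
    \<comment> \<open>The estimate is available for \<open>0 < d < t\<close>, which is a right
      neighbourhood of 0.\<close>
    moreover have "eventually (\<lambda>d. norm (comb a (S \<union> D)) \<le> norm (comb a (S \<union> B)) + d * norm (e N)) (at_right 0)"
      unfolding eventually_at_right_field using step t by blast
    ultimately have "norm (comb a (S \<union> D)) \<le> norm (comb a (S \<union> B)) + 0 * norm (e N)"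
      by (rule tendsto_lowerbound) simp
    then show ?thesis by simp
  qed
qed

end

theorem corollary1p9:
  fixes e :: "nat \<Rightarrow> 'a::banach"
  assumes "schauder_basis e" and "semi_normalized e"
  shows "(greedy_basis 1 e \<longleftrightarrow> property_Q_star 1 e) \<and>
         (property_Q_star 1 e \<longleftrightarrow> suppression_unconditional 1 e \<and> property_A 1 e)"
proof -
  interpret seminormalized_basis e using assms by unfold_locales
  show ?thesis
    using greedy_iff Q_star_iff suppression_unconditional_iff exchange_imp_A A_imp_exchange by blast
qed

end
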